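(* Let $(a_1,a_2,\ldots,a_k)$ be a $(v,k)$ modular Golomb ruler with $v=td$ for positive integers $t,d$. Let $\sigma_t$ be the permutation of the set $\{0,1,\ldots,v-1\}$ such that $\sigma_t(ad+b)=bt+a$ for $0\le a\le t-1$, $0\le b\le d-1$. For $h=0,1,\ldots,t-1$ let $$B_h=\Big\{\tfrac{a_i-h}{t}\ \Big|\ 1\le i\le k,\ a_i\equiv h \pmod t\Big\},\qquad w_h=|B_h|.$$ Let $\mathbf{A}_{\sigma_t}$ be the $v\times v$ $01$-matrix, with rows and columns indexed by $\{0,\ldots,v-1\}$, whose entry in position $(i,j)$ is $1$ if and only if $\sigma_t(j)-\sigma_t(i) \bmod v$ belongs to $\{a_1 \bmod v,\ldots,a_k \bmod v\}$. Divide $\mathbf{A}_{\sigma_t}$ into $d\times d$ blocks. Let $\mathbf{M}_0,\mathbf{M}_1,\ldots,\mathbf{M}_{t-1}$ be the $d\times d$ blocks such that the first $d$ rows of $\mathbf{A}_{\sigma_t}$ form the block row $[\mathbf{M}_0\ \mathbf{M}_1\ \ldots\ \mathbf{M}_{t-1}]$, and let $\mathbf{T}_1,\ldots,\mathbf{T}_{t-1}$ be the $d\times d$ blocks such that the first $d$ columns of $\mathbf{A}_{\sigma_t}$ form the block column whose blocks, from top to bottom, are $\mathbf{M}_0,\mathbf{T}_{t-1},\ldots,\mathbf{T}_2,\mathbf{T}_1$. Then: (i) Each matrix $\mathbf{M}_h$ ($0\le h\le t-1$) is a circulant $d\times d$ $01$-matrix of weight $w_h$, and the first row of $\mathbf{M}_h$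 corresponds to $B_h$, which is a $(d,w_h)$ modular Golomb ruler. (ii) Each matrix $\mathbf{T}_h$ ($1\le h\le t-1$) is a circulant $d\times d$ $01$-matrix of weight $w_h$ obtained from $\mathbf{M}_h$ by a cyclic shift of the rows to the right by one position. (iii) The matrix $\mathbf{A}_{\sigma_t}$ is a block double-circulant incidence matrix of a symmetric configuration $v_k$ with the following structure: $$\mathbf{A}_{\sigma_t}=\begin{bmatrix} \mathbf{M}_0&\mathbf{M}_1&\mathbf{M}_2&\ldots&\mathbf{M}_{t-2}&\mathbf{M}_{t-1}\\ \mathbf{T}_{t-1}&\mathbf{M}_0&\mathbf{M}_1&\ldots&\mathbf{M}_{t-3}&\mathbf{M}_{t-2}\\ \mathbf{T}_{t-2}&\mathbf{T}_{t-1}&\mathbf{M}_0&\ldots&\mathbf{M}_{t-4}&\mathbf{M}_{t-3}\\ \vdots&\vdots&\vdots&\vdots&\vdots&\vdots\\ \mathbf{T}_2&\mathbf{T}_3&\mathbf{T}_4&\ldots&\mathbf{M}_0&\mathbf{M}_1\\ \mathbf{T}_1&\mathbf{T}_2&\mathbf{T}_3&\ldots&\mathbf{T}_{t-1}&\mathbf{M}_0 \end{bmatrix},$$ that is, indexing block rows and block columns by $0,\ldots,t-1$, the block in position $(i,j)$ is $\mathbf{M}_{j-i}$ if $j\ge i$ and $\mathbf{T}_{t-(i-j)}$ if $j<i$.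
   Context: A $(v,k)$ modular Golomb ruler is an ordered set of $k$ integers $(a_1,\ldots,a_k)$ with $0\le a_1<a_2<\cdots<a_k$ such that all the differences $a_i-a_j$ ($1\le i,j\le k$, $i\ne j$) are distinct and nonzero modulo $v$. A symmetric configuration $v_k$ is an incidence structure with $v$ points and $v$ lines such that each line contains $k$ points, each point lies on $k$ lines, and two distinct points are connected by at most one line. An incidence matrix of it is a $v\times v$ $01$-matrix with rows indexed by lines and columns by points, an entry being $1$ exactly when the point lies on the line. A square matrix is circulant if each row is obtained from the previous row by a cyclic shift to the right by one position. The weight of a circulant $01$-matrix is the number of ones in each row. A $01$-vector $(u_0,\ldots,u_{d-1})$ corresponds to a modular Golomb ruler (modulo $d$) with set of elements $B$ if, for $j\in\{0,\ldots,d-1\}$, $u_j=1$ exactly when $j\equiv b\pmod d$ for some $b\in B$. The set $B_h$ is regarded as a ruler by listing its elements in increasing order. Let $v=td$. A $v\times v$ $01$-matrix, divided into $d\times d$ blocks $\mathbf{C}_{i,j}$ ($0\le i,j\le t-1$), is block double-circulant if every $\mathbf{C}_{i,j}$ is circulant and blocks $\mathbf{C}_{i,j}$, $\mathbf{C}_{l,m}$ with $j-i\equiv m-l\pmod t$ have equal weights. *)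

theory Defs
  imports "Jordan_Normal_Form.Matrix" "HOL-Number_Theory.Cong"
begin

definition modular_golomb_ruler :: "nat \<Rightarrow> nat \<Rightarrow> int list \<Rightarrow> bool" where
  "modular_golomb_ruler v k a \<longleftrightarrow>
     length a = k \<and> sorted_wrt (<) a \<and> (\<forall>x \<in> set a. 0 \<le> x) \<and>
     inj_on (\<lambda>(i, j). (a ! i - a ! j) mod int v) {(i, j). i < k \<and> j < k \<and> i \<noteq> j} \<and>
     (\<forall>i<k. \<forall>j<k. i \<noteq> j \<longrightarrow> (a ! i - a ! j) mod int v \<noteq> 0)"

(* The lines are abstract objects and not sets of points, so that distinct lines may be
   incident with the same points. *)
definition symmetric_configuration ::
    "nat \<Rightarrow> nat \<Rightarrow> 'p set \<Rightarrow> 'l set \<Rightarrow> ('p \<Rightarrow> 'l \<Rightarrow> bool) \<Rightarrow> bool" where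
  "symmetric_configuration v k P L I \<longleftrightarrow>
     finite P \<and> card P = v \<and> finite L \<and> card L = v \<and>
     (\<forall>l\<in>L. card {p \<in> P. I p l} = k) \<and>
     (\<forall>p\<in>P. card {l \<in> L. I p l} = k) \<and>
     (\<forall>p\<in>P. \<forall>q\<in>P. p \<noteq> q \<longrightarrow>
        (\<forall>l\<in>L. \<forall>m\<in>L. I p l \<and> I q l \<and> I p m \<and> I q m \<longrightarrow> l = m))"

(* Rows are lines and columns are points, in some order. *)
definition incidence_matrix ::
    "int mat \<Rightarrow> 'p set \<Rightarrow> 'l set \<Rightarrow> ('p \<Rightarrow> 'l \<Rightarrow> bool) \<Rightarrow> bool" where
  "incidence_matrix A P L I \<longleftrightarrow>
     (\<exists>ln pt. bij_betw ln {0..<dim_row A} L \<and> bij_betw pt {0..<dim_col A} P \<and>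
        (\<forall>i<dim_row A. \<forall>j<dim_col A. A $$ (i, j) = (if I (pt j) (ln i) then 1 else 0)))"

definition zero_one_mat :: "int mat \<Rightarrow> bool" where
  "zero_one_mat A \<longleftrightarrow> elements_mat A \<subseteq> {0, 1}"

definition shift_right :: "'a vec \<Rightarrow> 'a vec" where
  "shift_right u = vec (dim_vec u) (\<lambda>j. u $ ((j + dim_vec u - 1) mod dim_vec u))"

definition shift_rows_right :: "'a mat \<Rightarrow> 'a mat" where
  "shift_rows_right A = mat_of_rows (dim_col A) (map shift_right (rows A))"

definition circulant :: "'a mat \<Rightarrow> bool" where
  "circulant A \<longleftrightarrow> square_mat A \<and>
     (\<forall>i. Suc i < dim_row A \<longrightarrow> row A (Suc i) = shift_right (row A i))"

definition has_weight :: "int mat \<Rightarrow> nat \<Rightarrow> bool" where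
  "has_weight A w \<longleftrightarrow> (\<forall>i<dim_row A. card {j. j < dim_col A \<and> A $$ (i, j) = 1} = w)"

definition corresponds_to :: "nat \<Rightarrow> int vec \<Rightarrow> int set \<Rightarrow> bool" where
  "corresponds_to d u B \<longleftrightarrow> dim_vec u = d \<and> set\<^sub>v u \<subseteq> {0, 1} \<and>
     (\<forall>j<d. u $ j = 1 \<longleftrightarrow> (\<exists>b\<in>B. [int j = b] (mod int d)))"

definition block :: "nat \<Rightarrow> 'a mat \<Rightarrow> nat \<Rightarrow> nat \<Rightarrow> 'a mat" where
  "block d A i j = mat d d (\<lambda>(r, s). A $$ (i * d + r, j * d + s))"

definition block_double_circulant :: "nat \<Rightarrow> nat \<Rightarrow> int mat \<Rightarrow> bool" where
  "block_double_circulant t d A \<longleftrightarrow>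
     A \<in> carrier_mat (t * d) (t * d) \<and> zero_one_mat A \<and>
     (\<forall>i<t. \<forall>j<t. circulant (block d A i j)) \<and>
     (\<forall>i<t. \<forall>j<t. \<forall>l<t. \<forall>m<t. [int j - int i = int m - int l] (mod int t) \<longrightarrow>
        (\<exists>w. has_weight (block d A i j) w \<and> has_weight (block d A l m) w))"

(* The function with a * d + b |-> b * t + a for a < t and b < d. *)
definition sigma :: "nat \<Rightarrow> nat \<Rightarrow> nat \<Rightarrow> nat" where
  "sigma t d n = (n mod d) * t + n div d"

lemma sigma_apply: "b < d \<Longrightarrow> sigma t d (a * d + b) = b * t + a"
  by (simp add: sigma_def)

lemma sigma_less:
  assumes "n < t * d"
  shows "sigma t d n < t * d"
proof -
  have d: "0 < d" using assms by (cases d) auto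
  have "n div d < t" using assms by (simp add: less_mult_imp_div_less)
  then have "sigma t d n < (n mod d) * t + t" by (simp add: sigma_def)
  also have "\<dots> = Suc (n mod d) * t" by simp
  also have "\<dots> \<le> d * t" using d by (intro mult_le_mono1) (simp add: Suc_leI)
  finally show ?thesis by (simp add: mult.commute)
qed

lemma sigma_sigma:
  assumes "n < t * d"
  shows "sigma d t (sigma t d n) = n"
proof -
  have "n div d < t" using assms by (simp add: less_mult_imp_div_less)
  then have "sigma d t ((n mod d) * t + n div d) = (n div d) * d + n mod d"
    by (rule sigma_apply)
  then show ?thesis by (simp add: sigma_def)
qed

lemma bij_betw_sigma: "bij_betw (sigma t d) {0..<t * d} {0..<t * d}"
proof (rule bij_betw_byWitness[where f' = "sigma d t"])
  show "\<forall>n\<in>{0..<t * d}. sigma d t (sigma t d n) = n"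
    by (simp add: sigma_sigma)
  show "\<forall>n\<in>{0..<t * d}. sigma t d (sigma d t n) = n"
    using sigma_sigma[of _ d t] by (simp add: mult.commute)
  show "sigma t d ` {0..<t * d} \<subseteq> {0..<t * d}"
    using sigma_less by force
  show "sigma d t ` {0..<t * d} \<subseteq> {0..<t * d}"
    using sigma_less[of _ d t] by (auto simp: mult.commute[of t d])
qed

(* The division is exact on the elements selected. *)
definition subruler :: "nat \<Rightarrow> int list \<Rightarrow> nat \<Rightarrow> int set" where
  "subruler t a h =
     {(a ! i - int h) div int t | i. i < length a \<and> [a ! i = int h] (mod int t)}"

definition ruler_matrix :: "nat \<Rightarrow> (nat \<Rightarrow> nat) \<Rightarrow> int list \<Rightarrow> int mat" where
  "ruler_matrix v \<sigma> a = mat v v (\<lambda>(i, j).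
     if (int (\<sigma> j) - int (\<sigma> i)) mod int v \<in> {x mod int v | x. x \<in> set a} then 1 else 0)"

end

theory Submission
  imports Defs
begin

text \<open>
  In the numbering by \<^term>\<open>sigma t d\<close>, the row \<open>r\<close> of block row \<open>i\<close> and the column \<open>s\<close> of block
  column \<open>j\<close> carry the labels \<open>r * t + i\<close> and \<open>s * t + j\<close>, so the entry there depends only on
  \<open>(s - r) * t + (j - i)\<close> modulo \<open>t * d\<close>. Let \<open>h\<close> be the residue of \<open>j - i\<close> modulo \<open>t\<close>. A mark of
  the ruler can be congruent to this number only if it has the form \<open>h + t * b\<close>, that is, if \<open>b\<close>
  lies in \<open>B h\<close>; cancelling \<open>h\<close> and the factor \<open>t\<close> leaves the condition \<open>s - r = b\<close> modulo \<open>d\<close> if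
  \<open>i \<le> j\<close>. If \<open>j < i\<close>, then \<open>j - i = h - t\<close>, and the extra \<open>- t\<close> becomes a shift by one:
  \<open>s - r - 1 = b\<close> modulo \<open>d\<close>. Every block is therefore the circulant matrix of the set \<open>B h\<close>, shifted
  to the right by 0 or 1 (\<open>block_ruler_matrix\<close>), which gives all structural claims at once.

  The arithmetic claims concern differences only. In a modular Golomb ruler two distinct elements
  are determined by their difference modulo \<open>v\<close>; this passes from the marks \<open>h + t * b\<close>
  modulo \<open>t * d\<close> to the numbers \<open>b\<close> modulo \<open>d\<close>. For the whole matrix, the difference of the labels of
  two points on a common line is a difference of two marks, hence it determines these marks, and
  with them the label of the line (\<open>symmetric_configuration_ruler_matrix\<close>).
\<close>

section \<open>Sets with distinct differences\<close>

text \<open>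
  Allowing \<open>x' = y'\<close> in the premise makes this single condition cover both requirements on a ruler:
  with \<open>x' = y' = x\<close> it says that distinct elements are incongruent.
\<close>
definition distinct_differences :: "nat \<Rightarrow> int set \<Rightarrow> bool" where
  "distinct_differences v X \<longleftrightarrow>
     (\<forall>x\<in>X. \<forall>y\<in>X. \<forall>x'\<in>X. \<forall>y'\<in>X.
        x \<noteq> y \<and> [x - y = x' - y'] (mod int v) \<longrightarrow> x = x' \<and> y = y')"

lemma distinct_differencesD:
  assumes "distinct_differences v X" "x \<in> X" "y \<in> X" "x' \<in> X" "y' \<in> X"
    and "x \<noteq> y" "[x - y = x' - y'] (mod int v)"
  shows "x = x'" "y = y'"
  using assms unfolding distinct_differences_def by blast+

lemma distinct_differences_inj_on_mod:
  assumes "distinct_differences v X"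
  shows "inj_on (\<lambda>x. x mod int v) X"
proof (rule inj_onI, rule ccontr)
  fix x y assume xy: "x \<in> X" "y \<in> X" "x mod int v = y mod int v" "x \<noteq> y"
  then have "[x - y = x - x] (mod int v)"
    by (auto simp: cong_def mod_eq_dvd_iff)
  then show False
    using distinct_differencesD(2)[OF assms xy(1,2,1,1,4)] xy(4) by simp
qed

text \<open>
  Speaking of elements instead of positions in a list makes the difference condition easy to
  transfer to subrulers, which arise as sets.
\<close>
lemma modular_golomb_ruler_iff_distinct_differences:
  "modular_golomb_ruler v k a \<longleftrightarrow>
     length a = k \<and> sorted_wrt (<) a \<and> (\<forall>x\<in>set a. 0 \<le> x) \<and> distinct_differences v (set a)"
proof (cases "length a = k \<and> sorted_wrt (<) a")
  case False
  then show ?thesis by (auto simp: modular_golomb_ruler_def)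
next
  case True
  then have len: "length a = k" and dist: "distinct a"
    by (simp_all add: strict_sorted_iff)
  have nth_eq: "a ! i = a ! j \<longleftrightarrow> i = j" if "i < k" "j < k" for i j
    using that dist len by (simp add: nth_eq_iff_index_eq)
  let ?D = "{(i, j). i < k \<and> j < k \<and> i \<noteq> j}"
  let ?f = "\<lambda>(i, j). (a ! i - a ! j) mod int v"
  have "inj_on ?f ?D \<and> (\<forall>i<k. \<forall>j<k. i \<noteq> j \<longrightarrow> (a ! i - a ! j) mod int v \<noteq> 0)
    \<longleftrightarrow> distinct_differences v (set a)" (is "?L \<longleftrightarrow> ?R")
  proof
    assume L: ?L
    show ?R unfolding distinct_differences_def
    proof (intro ballI impI)
      fix x y x' y'
      assume "x \<in> set a" "y \<in> set a" "x' \<in> set a" "y' \<in> set a"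
        and *: "x \<noteq> y \<and> [x - y = x' - y'] (mod int v)"
      then obtain i j i' j' where ij: "i < k" "j < k" "i' < k" "j' < k"
        and xy: "x = a ! i" "y = a ! j" "x' = a ! i'" "y' = a ! j'"
        by (auto simp: in_set_conv_nth len)
      have eq: "?f (i, j) = ?f (i', j')" using * xy by (simp add: cong_def)
      have "i \<noteq> j" using * xy by auto
      then have "?f (i, j) \<noteq> 0" using L ij by simp
      then have "i' \<noteq> j'" using eq by auto
      have "(i, j) = (i', j')"
        by (rule inj_onD[OF conjunct1[OF L] eq]) (use ij \<open>i \<noteq> j\<close> \<open>i' \<noteq> j'\<close> in auto)
      then show "x = x' \<and> y = y'" using xy by simp
    qed
  next
    assume R: ?R
    have "(i, j) = (i', j')"
      if "i < k" "j < k" "i' < k" "j' < k" "i \<noteq> j" "?f (i, j) = ?f (i', j')" for i j i' j'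
      using distinct_differencesD[OF R, of "a ! i" "a ! j" "a ! i'" "a ! j'"] that
      by (auto simp: len nth_eq cong_def)
    then have "inj_on ?f ?D" by (intro inj_onI) auto
    moreover have "(a ! i - a ! j) mod int v \<noteq> 0" if "i < k" "j < k" "i \<noteq> j" for i j
      using distinct_differencesD[OF R, of "a ! i" "a ! j" "a ! i" "a ! i"] that
      by (auto simp: len nth_eq cong_def)
    ultimately show ?L by simp
  qed
  then show ?thesis using True by (simp only: modular_golomb_ruler_def simp_thms)
qed

text \<open>
  Each \<open>b \<in> X\<close> contributes exactly one solution, the least nonnegative residue of \<open>b + c\<close>, and
  these are different because the elements of \<open>X\<close> are incongruent. All row and column sums below
  are instances of this count.
\<close>
lemma card_translate_mod:
  assumes n: "0 < n" and inj: "inj_on (\<lambda>b. b mod int n) X"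
  shows "card {s. s < n \<and> (\<exists>b\<in>X. [int s = b + c] (mod int n))} = card X"
proof -
  let ?g = "\<lambda>b. nat ((b + c) mod int n)"
  have "inj_on ?g X"
  proof (rule inj_onI)
    fix x y assume xy: "x \<in> X" "y \<in> X" "?g x = ?g y"
    then have "[x + c = y + c] (mod int n)"
      using n by (simp add: cong_def eq_nat_nat_iff)
    then have "x mod int n = y mod int n"
      by (simp add: cong_add_rcancel cong_def[symmetric])
    then show "x = y" using inj xy by (auto dest: inj_onD)
  qed
  moreover have "?g ` X = {s. s < n \<and> (\<exists>b\<in>X. [int s = b + c] (mod int n))}"
  proof (intro Set.set_eqI iffI)
    fix s assume "s \<in> ?g ` X"
    then show "s \<in> {s. s < n \<and> (\<exists>b\<in>X. [int s = b + c] (mod int n))}"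
      using n by (auto simp: cong_def nat_less_iff)
  next
    fix s assume "s \<in> {s. s < n \<and> (\<exists>b\<in>X. [int s = b + c] (mod int n))}"
    then obtain b where b: "s < n" "b \<in> X" "int s mod int n = (b + c) mod int n"
      by (auto simp: cong_def)
    then have "?g b = s" by simp
    then show "s \<in> ?g ` X" using b by blast
  qed
  ultimately show ?thesis using card_image[of ?g X] by simp
qed

section \<open>The subrulers\<close>

lemma subruler_eq:
  assumes "0 < t"
  shows "subruler t a h = {b. int h + int t * b \<in> set a}"
proof (intro Set.set_eqI iffI)
  fix b assume "b \<in> subruler t a h"
  then obtain i where i: "i < length a" "[a ! i = int h] (mod int t)"
    and b: "b = (a ! i - int h) div int t" by (auto simp: subruler_def)
  have "int h + int t * b = a ! i"
    using i b by (simp add: cong_iff_dvd_diff)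
  then show "b \<in> {b. int h + int t * b \<in> set a}" using i by simp
next
  fix b assume "b \<in> {b. int h + int t * b \<in> set a}"
  then obtain i where "i < length a" "a ! i = int h + int t * b"
    by (auto simp: in_set_conv_nth)
  then show "b \<in> subruler t a h"
    using assms by (auto simp: subruler_def cong_iff_dvd_diff intro!: exI[of _ i])
qed

lemma finite_subruler: "finite (subruler t a h)"
  by (simp add: subruler_def)

text \<open>
  The map \<open>b \<mapsto> h + t * b\<close> multiplies differences by \<open>t\<close>, so it turns equality of differences
  modulo \<open>d\<close> into equality modulo \<open>t * d\<close>.
\<close>
lemma distinct_differences_subruler:
  assumes t: "0 < t" and dd: "distinct_differences (t * d) (set a)"
  shows "distinct_differences d (subruler t a h)"
  unfolding distinct_differences_def subruler_eq[OF t]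
proof (intro ballI impI, unfold mem_Collect_eq)
  fix x y x' y'
  let ?m = "\<lambda>b. int h + int t * b"
  assume mem: "?m x \<in> set a" "?m y \<in> set a" "?m x' \<in> set a" "?m y' \<in> set a"
    and *: "x \<noteq> y \<and> [x - y = x' - y'] (mod int d)"
  have "int t * int d dvd int t * ((x - y) - (x' - y'))"
    using * by (auto simp: cong_iff_dvd_diff)
  moreover have "int t * ((x - y) - (x' - y')) = (?m x - ?m y) - (?m x' - ?m y')"
    by (simp add: algebra_simps)
  ultimately have "[?m x - ?m y = ?m x' - ?m y'] (mod int (t * d))"
    by (simp only: cong_iff_dvd_diff of_nat_mult)
  moreover have "?m x \<noteq> ?m y" using * t by simp
  ultimately show "x = x' \<and> y = y'"
    using distinct_differencesD[OF dd mem] t by simp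
qed

lemma modular_golomb_ruler_subruler:
  assumes ruler: "modular_golomb_ruler (t * d) k a" and t: "0 < t" and h: "h < t"
  shows "modular_golomb_ruler d (card (subruler t a h)) (sorted_list_of_set (subruler t a h))"
proof -
  have "0 \<le> b" if "b \<in> subruler t a h" for b
  proof (rule ccontr)
    assume "\<not> 0 \<le> b"
    \<comment> \<open>A negative \<open>b\<close> belongs to a mark of size at most \<open>h - t\<close>, but marks are nonnegative.\<close>
    then have "int t * b \<le> int t * (- 1)" by (intro mult_left_mono) auto
    then have "int h + int t * b < 0" using h by simp
    then show False
      using that ruler
      by (auto simp: subruler_eq[OF t] modular_golomb_ruler_iff_distinct_differences)
  qed
  then show ?thesis
    using ruler distinct_differences_subruler[OF t, of d a h]
    by (simp add: modular_golomb_ruler_iff_distinct_differences finite_subruler)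
qed

text \<open>
  This is where the blocks come from: modulo \<open>t * d\<close>, a number with residue \<open>h\<close> modulo \<open>t\<close> can only
  meet the marks with residue \<open>h\<close>, and on these the factor \<open>t\<close> cancels.
\<close>
lemma cong_mark_iff_cong_subruler:
  assumes t: "0 < t"
  shows "(\<exists>x\<in>set a. [int h + int t * m = x] (mod int (t * d))) \<longleftrightarrow>
    (\<exists>b\<in>subruler t a h. [m = b] (mod int d))"
proof
  assume "\<exists>x\<in>set a. [int h + int t * m = x] (mod int (t * d))"
  then obtain x q where x: "x \<in> set a" and q: "int h + int t * m - x = int t * int d * q"
    by (auto simp: cong_iff_dvd_diff dvd_def)
  let ?b = "m - int d * q"
  have "int h + int t * ?b = x" using q by (simp add: algebra_simps)
  then have "?b \<in> subruler t a h" using x by (simp add: subruler_eq[OF t])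
  moreover have "[m = ?b] (mod int d)" by (simp add: cong_iff_dvd_diff)
  ultimately show "\<exists>b\<in>subruler t a h. [m = b] (mod int d)" by blast
next
  assume "\<exists>b\<in>subruler t a h. [m = b] (mod int d)"
  then obtain b where b: "int h + int t * b \<in> set a" "int d dvd m - b"
    by (auto simp: cong_iff_dvd_diff subruler_eq[OF t])
  have "int t * int d dvd int t * (m - b)" using b(2) by simp
  then have "[int h + int t * m = int h + int t * b] (mod int (t * d))"
    by (simp add: cong_iff_dvd_diff algebra_simps)
  then show "\<exists>x\<in>set a. [int h + int t * m = x] (mod int (t * d))" using b(1) by blast
qed

section \<open>Circulant matrices of sets of residues\<close>

text \<open>
  The first row is the indicator vector of the residues of \<open>X\<close>, shifted to the right by \<open>e\<close>. The
  parameter \<open>e\<close> lets one family of matrices describe the blocks on both sides of the diagonal.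
\<close>
definition circulant_of :: "nat \<Rightarrow> int set \<Rightarrow> int \<Rightarrow> int mat" where
  "circulant_of d X e =
     mat d d (\<lambda>(r, s). if \<exists>b\<in>X. [int s - int r - e = b] (mod int d) then 1 else 0)"

lemma circulant_of_carrier [simp]:
  "circulant_of d X e \<in> carrier_mat d d"
  "dim_row (circulant_of d X e) = d"
  "dim_col (circulant_of d X e) = d"
  by (simp_all add: circulant_of_def)

lemma circulant_of_index:
  "r < d \<Longrightarrow> s < d \<Longrightarrow> circulant_of d X e $$ (r, s) =
     (if \<exists>b\<in>X. [int s - int r - e = b] (mod int d) then 1 else 0)"
  by (simp add: circulant_of_def)

lemma zero_one_mat_circulant_of: "zero_one_mat (circulant_of d X e)"
  by (auto simp: zero_one_mat_def elements_mat_def circulant_of_def)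

text \<open>
  Entries depend only on \<open>s - r - e\<close>, so shifting a row has the same effect as increasing \<open>r\<close> by
  one, which gives circularity, or \<open>e\<close> by one, which gives the shifted matrix.
\<close>
lemma shift_right_row_circulant_of:
  assumes "r < d"
  shows "shift_right (row (circulant_of d X e) r) =
    vec d (\<lambda>s. if \<exists>b\<in>X. [int s - int r - (e + 1) = b] (mod int d) then 1 else 0)"
proof (rule eq_vecI)
  fix s assume "s < dim_vec (vec d (\<lambda>s. if \<exists>b\<in>X. [int s - int r - (e + 1) = b] (mod int d)
    then 1 else 0 :: int))"
  then have s: "s < d" by simp
  let ?s = "(s + d - 1) mod d"
  have "?s < d" using assms by simp
  have "[int ?s = int s + int d - 1] (mod int d)"
    using s by (simp add: cong_def zmod_int)
  moreover have "[int s + int d - 1 = int s - 1] (mod int d)"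
    by (simp add: cong_iff_dvd_diff)
  ultimately have "[int ?s = int s - 1] (mod int d)"
    by (rule cong_trans)
  then have "[int ?s - (int r + e) = int s - 1 - (int r + e)] (mod int d)"
    by (intro cong_diff cong_refl)
  then have "[int ?s - int r - e = b] (mod int d) \<longleftrightarrow> [int s - int r - (e + 1) = b] (mod int d)"
    for b
    by (simp add: cong_def algebra_simps)
  then show "shift_right (row (circulant_of d X e) r) $ s =
    vec d (\<lambda>s. if \<exists>b\<in>X. [int s - int r - (e + 1) = b] (mod int d) then 1 else 0) $ s"
    using assms s \<open>?s < d\<close> by (simp add: shift_right_def circulant_of_index)
qed (simp add: shift_right_def)

lemma circulant_circulant_of: "circulant (circulant_of d X e)"
  unfolding circulant_def
proof (intro conjI allI impI)
  fix r assume "Suc r < dim_row (circulant_of d X e)"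
  then have r: "Suc r < d" by simp
  then show "row (circulant_of d X e) (Suc r) = shift_right (row (circulant_of d X e) r)"
    by (subst shift_right_row_circulant_of)
       (auto simp: circulant_of_index algebra_simps)
qed simp

lemma shift_rows_right_circulant_of:
  "shift_rows_right (circulant_of d X e) = circulant_of d X (e + 1)"
  by (rule eq_matI)
     (auto simp: shift_rows_right_def mat_of_rows_index shift_right_row_circulant_of
        circulant_of_index)

lemma has_weight_circulant_of:
  assumes d: "0 < d" and inj: "inj_on (\<lambda>b. b mod int d) X"
  shows "has_weight (circulant_of d X e) (card X)"
  unfolding has_weight_def
proof (intro allI impI)
  fix r assume "r < dim_row (circulant_of d X e)"
  then have r: "r < d" by simp
  have "[int s - int r - e = b] (mod int d) \<longleftrightarrow> [int s = b + (int r + e)] (mod int d)" for s b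
    by (simp add: cong_iff_dvd_diff algebra_simps)
  then have "{s. s < dim_col (circulant_of d X e) \<and> circulant_of d X e $$ (r, s) = 1} =
    {s. s < d \<and> (\<exists>b\<in>X. [int s = b + (int r + e)] (mod int d))}"
    using r by (auto simp: circulant_of_index split: if_splits)
  then show "card {s. s < dim_col (circulant_of d X e) \<and> circulant_of d X e $$ (r, s) = 1} = card X"
    using card_translate_mod[OF d inj] by simp
qed

lemma corresponds_to_circulant_of:
  assumes "0 < d"
  shows "corresponds_to d (row (circulant_of d X 0) 0) X"
  using assms by (auto simp: corresponds_to_def vec_set_def circulant_of_index split: if_splits)

section \<open>The blocks of the ruler matrix\<close>

lemma ruler_matrix_index:
  "i < v \<Longrightarrow> j < v \<Longrightarrow> ruler_matrix v \<sigma> a $$ (i, j) =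
     (if \<exists>x\<in>set a. [int (\<sigma> j) - int (\<sigma> i) = x] (mod int v) then 1 else 0)"
  by (auto simp: ruler_matrix_def cong_def)

lemma ruler_matrix_carrier: "ruler_matrix v \<sigma> a \<in> carrier_mat v v"
  by (simp add: ruler_matrix_def)

lemma zero_one_mat_ruler_matrix: "zero_one_mat (ruler_matrix v \<sigma> a)"
  by (auto simp: zero_one_mat_def elements_mat_def ruler_matrix_def)

text \<open>
  Below the diagonal the label difference \<open>(s - r) * t + (j - i)\<close> has residue \<open>h = t - (i - j)\<close>
  modulo \<open>t\<close>; writing it as \<open>h + t * (s - r - 1)\<close> costs one unit of \<open>s - r\<close>, which is the shift.
\<close>
lemma block_ruler_matrix:
  assumes t: "0 < t" and i: "i < t" and j: "j < t"
  shows "block d (ruler_matrix (t * d) (sigma t d) a) i j =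
    (if i \<le> j then circulant_of d (subruler t a (j - i)) 0
     else circulant_of d (subruler t a (t - (i - j))) 1)"
proof -
  define h :: nat where "h = (if i \<le> j then j - i else t - (i - j))"
  define e :: int where "e = (if i \<le> j then 0 else 1)"
  have h: "int h = int j - int i + int t * e"
    using i by (auto simp: h_def e_def)
  have less: "l * d + r < t * d" if "l < t" "r < d" for l r
  proof -
    have "l * d + r < Suc l * d" using that by simp
    also have "\<dots> \<le> t * d" using that by (intro mult_le_mono1) simp
    finally show ?thesis .
  qed
  have "block d (ruler_matrix (t * d) (sigma t d) a) i j = circulant_of d (subruler t a h) e"
  proof (rule eq_matI)
    fix r s assume "r < dim_row (circulant_of d (subruler t a h) e)"
      "s < dim_col (circulant_of d (subruler t a h) e)"
    then have rs: "r < d" "s < d" by auto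
    have "int (sigma t d (j * d + s)) - int (sigma t d (i * d + r)) =
      int h + int t * (int s - int r - e)"
      unfolding sigma_apply[OF rs(1)] sigma_apply[OF rs(2)] h by (simp add: algebra_simps)
    then show "block d (ruler_matrix (t * d) (sigma t d) a) i j $$ (r, s) =
      circulant_of d (subruler t a h) e $$ (r, s)"
      using rs less[OF i] less[OF j] cong_mark_iff_cong_subruler[OF t, of a h "int s - int r - e" d]
      by (simp add: block_def ruler_matrix_index circulant_of_index)
  qed (simp_all add: block_def)
  then show ?thesis by (simp add: h_def e_def)
qed

text \<open>
  A circulant block has the weight of its subruler, whatever its shift, so the weight of block
  \<open>(i, j)\<close> depends only on the residue of \<open>j - i\<close> modulo \<open>t\<close>.
\<close>
lemma block_double_circulant_ruler_matrix:
  assumes t: "0 < t" and d: "0 < d" and dd: "distinct_differences (t * d) (set a)"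
  shows "block_double_circulant t d (ruler_matrix (t * d) (sigma t d) a)"
proof -
  let ?A = "ruler_matrix (t * d) (sigma t d) a"
  let ?h = "\<lambda>i j. nat ((int j - int i) mod int t)"
  have weight: "has_weight (block d ?A i j) (card (subruler t a (?h i j)))"
    if ij: "i < t" "j < t" for i j
  proof -
    have "(int j - int i) mod int t = (if i \<le> j then int (j - i) else int (t - (i - j)))"
    proof (cases "i \<le> j")
      case False
      then have "(int j - int i) mod int t = (int j - int i + int t) mod int t" by simp
      also have "\<dots> = int j - int i + int t" using False ij by (intro mod_pos_pos_trivial) auto
      finally show ?thesis using False ij by simp
    qed (use ij in simp)
    then have "?h i j = (if i \<le> j then j - i else t - (i - j))" by auto
    then show ?thesis
      using has_weight_circulant_of[OF d
          distinct_differences_inj_on_mod[OF distinct_differences_subruler[OF t dd]]]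
      by (simp add: block_ruler_matrix[OF t ij])
  qed
  have "\<exists>w. has_weight (block d ?A i j) w \<and> has_weight (block d ?A l m) w"
    if "i < t" "j < t" "l < t" "m < t" "[int j - int i = int m - int l] (mod int t)" for i j l m
    using weight[of i j] weight[of l m] that by (auto simp: cong_def)
  then show ?thesis
    by (auto simp: block_double_circulant_def ruler_matrix_carrier zero_one_mat_ruler_matrix
        block_ruler_matrix[OF t] circulant_circulant_of)
qed

section \<open>The symmetric configuration\<close>

text \<open>
  Rows and columns are relabelled by the same permutation, so counting along a row or column is
  counting residues: a row with label \<open>c\<close> meets the translate of the ruler by \<open>c\<close>, and a column
  with label \<open>c\<close> meets the translate by \<open>c\<close> of the negated ruler. Two points on a common line
  differ by a difference \<open>x - y\<close> of marks, so a second common line yields the same \<open>x\<close>, and the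
  label of a line is the label of a point minus its mark.
\<close>
lemma symmetric_configuration_ruler_matrix:
  assumes ruler: "modular_golomb_ruler v k a" and v: "0 < v"
    and \<sigma>: "bij_betw \<sigma> {0..<v} {0..<v}"
  shows "symmetric_configuration v k {0..<v} {0..<v}
    (\<lambda>p l. ruler_matrix v \<sigma> a $$ (l, p) = 1)"
proof -
  have dd: "distinct_differences v (set a)" and len: "card (set a) = k"
    using ruler
    by (auto simp: modular_golomb_ruler_iff_distinct_differences strict_sorted_iff distinct_card)
  note inj = distinct_differences_inj_on_mod[OF dd]
  have inj_neg: "inj_on (\<lambda>b. b mod int v) (uminus ` set a)"
  proof (rule inj_onI)
    fix x y assume "x \<in> uminus ` set a" "y \<in> uminus ` set a" "x mod int v = y mod int v"
    then have "- x \<in> set a" "- y \<in> set a" "(- x) mod int v = (- y) mod int v"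
      by (auto intro: mod_minus_cong)
    then show "x = y" using inj by (auto dest: inj_onD)
  qed
  have inc: "ruler_matrix v \<sigma> a $$ (l, p) = 1 \<longleftrightarrow>
    (\<exists>x\<in>set a. [int (\<sigma> p) - int (\<sigma> l) = x] (mod int v))" if "p < v" "l < v" for p l
    using that by (simp add: ruler_matrix_index)
  have relabel: "card {p \<in> {0..<v}. Q (\<sigma> p)} = card {s. s < v \<and> Q s}" for Q
  proof (rule bij_betw_same_card, rule bij_betw_subset[OF \<sigma>])
    have "\<sigma> ` {p \<in> {0..<v}. Q (\<sigma> p)} = {s \<in> \<sigma> ` {0..<v}. Q s}" by blast
    then show "\<sigma> ` {p \<in> {0..<v}. Q (\<sigma> p)} = {s. s < v \<and> Q s}"
      using \<sigma> by (auto simp: bij_betw_def)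
  qed auto
  have line: "card {p \<in> {0..<v}. ruler_matrix v \<sigma> a $$ (l, p) = 1} = k" if "l < v" for l
  proof -
    have "[int s - int (\<sigma> l) = x] (mod int v) \<longleftrightarrow> [int s = x + int (\<sigma> l)] (mod int v)" for s x
      by (simp add: cong_iff_dvd_diff algebra_simps)
    then have "{p \<in> {0..<v}. ruler_matrix v \<sigma> a $$ (l, p) = 1} =
      {p \<in> {0..<v}. \<exists>x\<in>set a. [int (\<sigma> p) = x + int (\<sigma> l)] (mod int v)}"
      using that by (auto simp: inc)
    then show ?thesis
      using relabel[of "\<lambda>s. \<exists>x\<in>set a. [int s = x + int (\<sigma> l)] (mod int v)"]
        card_translate_mod[OF v inj] len by simp
  qed
  have point: "card {l \<in> {0..<v}. ruler_matrix v \<sigma> a $$ (l, p) = 1} = k" if "p < v" for p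
  proof -
    have "[int (\<sigma> p) - int s = x] (mod int v) \<longleftrightarrow> [int s = - x + int (\<sigma> p)] (mod int v)" for s x
      using dvd_minus_iff[of "int v" "int (\<sigma> p) - int s - x"]
      by (simp add: cong_iff_dvd_diff algebra_simps)
    then have "{l \<in> {0..<v}. ruler_matrix v \<sigma> a $$ (l, p) = 1} =
      {l \<in> {0..<v}. \<exists>b\<in>uminus ` set a. [int (\<sigma> l) = b + int (\<sigma> p)] (mod int v)}"
      using that by (auto simp: inc)
    then show ?thesis
      using relabel[of "\<lambda>s. \<exists>b\<in>uminus ` set a. [int s = b + int (\<sigma> p)] (mod int v)"]
        card_translate_mod[OF v inj_neg, of "int (\<sigma> p)"] len
      by (simp add: card_image)
  qed
  have residue: "s = s'" if "s < v" "s' < v" "[int s = int s'] (mod int v)" for s s'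
    using that by (simp add: cong_def)
  have \<sigma>_less: "\<sigma> p < v" if "p < v" for p
    using \<sigma> that by (auto simp: bij_betw_def)
  have \<sigma>_eq: "p = q" if "p < v" "q < v" "[int (\<sigma> p) = int (\<sigma> q)] (mod int v)" for p q
    using residue[OF \<sigma>_less \<sigma>_less, OF that] inj_onD[OF bij_betw_imp_inj_on[OF \<sigma>], of p q] that
    by simp
  have unique: "l = m"
    if lt: "p < v" "q < v" "l < v" "m < v" and pq: "p \<noteq> q"
      and on: "ruler_matrix v \<sigma> a $$ (l, p) = 1" "ruler_matrix v \<sigma> a $$ (l, q) = 1"
        "ruler_matrix v \<sigma> a $$ (m, p) = 1" "ruler_matrix v \<sigma> a $$ (m, q) = 1" for p q l m
  proof -
    obtain x y x' y' where mem: "x \<in> set a" "y \<in> set a" "x' \<in> set a" "y' \<in> set a"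
      and x: "[int (\<sigma> p) - int (\<sigma> l) = x] (mod int v)"
      and y: "[int (\<sigma> q) - int (\<sigma> l) = y] (mod int v)"
      and x': "[int (\<sigma> p) - int (\<sigma> m) = x'] (mod int v)"
      and y': "[int (\<sigma> q) - int (\<sigma> m) = y'] (mod int v)"
      using on lt by (auto simp: inc)
    have xy: "[int (\<sigma> p) - int (\<sigma> q) = x - y] (mod int v)"
      using cong_diff[OF x y] by simp
    have xy': "[int (\<sigma> p) - int (\<sigma> q) = x' - y'] (mod int v)"
      using cong_diff[OF x' y'] by simp
    have "x \<noteq> y"
      using xy \<sigma>_eq[OF lt(1,2)] pq by (auto simp: cong_diff_iff_cong_0)
    then have "x = x'"
      using distinct_differencesD(1)[OF dd mem] xy xy' by (metis cong_sym cong_trans)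
    then have "[int (\<sigma> p) - int (\<sigma> l) = int (\<sigma> p) - int (\<sigma> m)] (mod int v)"
      using x x' by (metis cong_sym cong_trans)
    from cong_diff[OF cong_refl[of "int (\<sigma> p)"] this]
    show "l = m" using \<sigma>_eq[OF lt(3,4)] by simp
  qed
  show ?thesis
    unfolding symmetric_configuration_def
  proof (intro conjI ballI impI)
    fix p q l m :: nat
    assume "p \<in> {0..<v}" "q \<in> {0..<v}" "p \<noteq> q" "l \<in> {0..<v}" "m \<in> {0..<v}"
      and "ruler_matrix v \<sigma> a $$ (l, p) = 1 \<and> ruler_matrix v \<sigma> a $$ (l, q) = 1 \<and>
        ruler_matrix v \<sigma> a $$ (m, p) = 1 \<and> ruler_matrix v \<sigma> a $$ (m, q) = 1"
    then show "l = m" using unique[of p q l m] by simp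
  qed (use line point in simp_all)
qed

theorem theorem3p5:
  fixes v k t d :: nat and a :: "int list"
    and B :: "nat \<Rightarrow> int set" and w :: "nat \<Rightarrow> nat"
    and A :: "int mat" and M T :: "nat \<Rightarrow> int mat"
  assumes ruler: "modular_golomb_ruler v k a"
    and v: "v = t * d" and t: "0 < t" and d: "0 < d"
    and B: "\<And>h. h < t \<Longrightarrow> B h = subruler t a h"
    and w: "\<And>h. h < t \<Longrightarrow> w h = card (B h)"
    and A: "A = ruler_matrix v (sigma t d) a"
    and M: "\<And>h. h < t \<Longrightarrow> M h = block d A 0 h"
    and T: "\<And>h. 1 \<le> h \<Longrightarrow> h < t \<Longrightarrow> T h = block d A (t - h) 0"
  shows "(\<forall>h<t. M h \<in> carrier_mat d d \<and> zero_one_mat (M h) \<and> circulant (M h) \<and>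
            has_weight (M h) (w h) \<and> corresponds_to d (row (M h) 0) (B h) \<and>
            modular_golomb_ruler d (w h) (sorted_list_of_set (B h))) \<and>
         (\<forall>h. 1 \<le> h \<and> h < t \<longrightarrow> T h \<in> carrier_mat d d \<and> zero_one_mat (T h) \<and>
            circulant (T h) \<and> has_weight (T h) (w h) \<and> T h = shift_rows_right (M h)) \<and>
         (block_double_circulant t d A \<and>
          (\<exists>(P :: nat set) (L :: nat set) I.
             symmetric_configuration v k P L I \<and> incidence_matrix A P L I) \<and>
          (\<forall>i<t. \<forall>j<t. block d A i j = (if i \<le> j then M (j - i) else T (t - (i - j)))))"
proof -
  have ruler': "modular_golomb_ruler (t * d) k a" using ruler v by simp
  then have dd: "distinct_differences (t * d) (set a)"
    by (simp add: modular_golomb_ruler_iff_distinct_differences)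
  have A': "A = ruler_matrix (t * d) (sigma t d) a" using A v by simp
  have M': "M h = circulant_of d (B h) 0" if "h < t" for h
    using that t by (simp add: M B A' block_ruler_matrix)
  have T': "T h = circulant_of d (B h) 1" if "1 \<le> h" "h < t" for h
    using that t by (simp add: T B A' block_ruler_matrix)
  have weight: "has_weight (circulant_of d (B h) e) (w h)" if "h < t" for h e
    using that has_weight_circulant_of[OF d
        distinct_differences_inj_on_mod[OF distinct_differences_subruler[OF t dd]]]
    by (simp add: B w)
  have subrulers: "modular_golomb_ruler d (w h) (sorted_list_of_set (B h))" if "h < t" for h
    using modular_golomb_ruler_subruler[OF ruler' t that] that by (simp add: B w)
  have blocks: "block d A i j = (if i \<le> j then M (j - i) else T (t - (i - j)))"
    if "i < t" "j < t" for i j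
    using that by (auto simp: A' block_ruler_matrix[OF t] M' T' B)
  have bdc: "block_double_circulant t d A"
    using block_double_circulant_ruler_matrix[OF t d dd] A' by simp
  have conf: "symmetric_configuration v k {0..<v} {0..<v} (\<lambda>p l. A $$ (l, p) = 1)"
    unfolding A
    by (rule symmetric_configuration_ruler_matrix[OF ruler])
       (use v t d bij_betw_sigma in auto)
  have "incidence_matrix A {0..<v} {0..<v} (\<lambda>p l. A $$ (l, p) = 1)"
    unfolding incidence_matrix_def
    by (intro exI[of _ id]) (auto simp: A ruler_matrix_def)
  with conf have "\<exists>(P :: nat set) (L :: nat set) I.
    symmetric_configuration v k P L I \<and> incidence_matrix A P L I" by blast
  then show ?thesis
    using bdc blocks subrulers weight corresponds_to_circulant_of[OF d]
    by (auto simp: M' T' zero_one_mat_circulant_of circulant_circulant_of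
        shift_rows_right_circulant_of)
qed

end
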